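(* For every real $\alpha > 1$, the maximum number $h(\alpha)$ of vertices of an empty polygon in $L(\alpha)=\{\alpha^n \colon n \in \mathbb{N}_0\}^2$ is finite. More precisely, $h(\alpha) \leq 5$ for every $\alpha \geq 2$, $h(\alpha) \leq 7$ for every $\alpha \in \left[\frac{1+\sqrt{5}}{2},2\right)$, and \[h(\alpha) \leq 3\left\lceil\log_\alpha\left(\frac{\alpha}{\alpha-1}\right)\right\rceil+3\] for every $\alpha \in \left(1,\frac{1+\sqrt{5}}{2}\right)$.
   Context: $\mathbb{N}_0=\{0,1,2,\dots\}$. For a real number $\alpha>1$, the exponential lattice is $L(\alpha)=\{\alpha^n \colon n \in \mathbb{N}_0\}^2=\{(\alpha^i,\alpha^j)\colon i,j\in\mathbb{N}_0\}\subseteq\mathbb{R}^2$. For a discrete set $S\subseteq\mathbb{R}^2$, a convex polygon $P$ with all vertices in $S$ is empty in $S$ if $P$ (including its boundary, in particular the interiors of its edges) contains no points of $S$ other than its vertices. $h(S)$ denotes the maximum number of vertices of an empty polygon in $S$, with $h(S)=\infty$ if there are empty polygons in $S$ with arbitrarily many vertices. $h(\alpha)$ abbreviates $h(L(\alpha))$. *)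

theory Defs
  imports "HOL-Analysis.Analysis" "HOL-Library.Extended_Nat"
begin

text \<open>The plane is the Euclidean space \<^typ>\<open>real \<times> real\<close>. Polygons are two-dimensional (no points or
  segments), and their vertices are their extreme points, so there are no straight angles.\<close>

definition convex_polygon :: "(real \<times> real) set \<Rightarrow> bool" where
  "convex_polygon P \<longleftrightarrow> polytope P \<and> aff_dim P = 2"

definition vertices :: "(real \<times> real) set \<Rightarrow> (real \<times> real) set" where
  "vertices P = {v. v extreme_point_of P}"

definition empty_polygon_in :: "(real \<times> real) set \<Rightarrow> (real \<times> real) set \<Rightarrow> bool" where
  "empty_polygon_in S P \<longleftrightarrow>
     convex_polygon P \<and> vertices P \<subseteq> S \<and> P \<inter> S \<subseteq> vertices P"

text \<open>The supremum is taken in \<^typ>\<open>enat\<close>: it is the maximum of the vertex counts if they are bounded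
  (and some empty polygon exists), and \<open>\<infinity>\<close> if they are unbounded.\<close>

definition h :: "(real \<times> real) set \<Rightarrow> enat" where
  "h S = (SUP P \<in> {P. empty_polygon_in S P}. enat (card (vertices P)))"

definition exponential_lattice :: "real \<Rightarrow> (real \<times> real) set" where
  "exponential_lattice \<alpha> = range (\<lambda>n::nat. \<alpha> ^ n) \<times> range (\<lambda>n::nat. \<alpha> ^ n)"

end

theory Submission
  imports Defs
begin

text \<open>Let \<open>\<alpha> \<le> \<alpha>\<^sup>k (\<alpha> - 1)\<close>, which is \<open>k \<ge> log\<^sub>\<alpha> (\<alpha> / (\<alpha> - 1))\<close>. An empty polygon has at most \<open>2 k + 3\<close>
  vertices. Comparing an extreme vertex with its lattice neighbour in the same row or column shows
  that two opposite corners of the bounding box are vertices. The diagonal joining them cuts the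
  polygon in two, and a vertex together with this diagonal spans a triangle that must not contain
  the lattice neighbours of the vertex. If the diagonal has negative slope, this limits the rows of the
  other vertices to the top \<open>k\<close> ones. If it has positive slope, it limits the ratio of the
  coordinates, because scaling by \<open>\<alpha>\<close> preserves the lattice and moves points along rays
  from the origin.\<close>

section \<open>Sections of convex sets in the plane\<close>

lemma vertical_section:
  fixes x y :: real
  assumes C: "convex C" and "(x, y1) \<in> C" "(x, y2) \<in> C" and "y1 \<le> y" "y \<le> y2"
  shows "(x, y) \<in> C"
proof (cases "y1 = y2")
  case False
  define l where "l = (y - y1) / (y2 - y1)"
  have l: "0 \<le> l" "l \<le> 1" "l * (y2 - y1) = y - y1"
    using assms False by (auto simp: l_def divide_simps)
  have "(1 - l) *\<^sub>R (x, y1) + l *\<^sub>R (x, y2) \<in> C"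
    using l by (intro convexD_alt[OF C]) (use assms in auto)
  moreover have "(1 - l) *\<^sub>R (x, y1) + l *\<^sub>R (x, y2) = (x, y)"
    using l(3) by (simp add: algebra_simps)
  ultimately show ?thesis by simp
qed (use assms in auto)

lemma convex_swap:
  fixes C :: "(real \<times> real) set"
  assumes "convex C"
  shows "convex (prod.swap ` C)"
  by (rule convex_linear_image[OF _ assms]) (auto intro!: linearI)

lemma horizontal_section:
  fixes x y :: real
  assumes "convex C" and "(x1, y) \<in> C" "(x2, y) \<in> C" and "x1 \<le> x" "x \<le> x2"
  shows "(x, y) \<in> C"
proof -
  have "(y, x) \<in> prod.swap ` C"
    by (rule vertical_section[OF convex_swap[OF assms(1)], of _ x1 x2]) (use assms in force)+
  then show ?thesis by auto
qed

lemma chord_at: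
  fixes x :: real
  assumes C: "convex C" and "(x1, y1) \<in> C" "(x2, y2) \<in> C" and "x1 \<le> x" "x \<le> x2" "x1 < x2"
  shows "(x, (y1 * (x2 - x) + y2 * (x - x1)) / (x2 - x1)) \<in> C"
proof -
  define l where "l = (x - x1) / (x2 - x1)"
  have l: "0 \<le> l" "l \<le> 1"
    using assms by (auto simp: l_def field_simps)
  have "(1 - l) *\<^sub>R (x1, y1) + l *\<^sub>R (x2, y2) \<in> C"
    using l by (intro convexD_alt[OF C]) (use assms in auto)
  moreover have "(1 - l) * x1 + l * x2 = x"
    using assms by (simp add: l_def divide_simps) (simp add: algebra_simps)?
  moreover have "(1 - l) * y1 + l * y2 = (y1 * (x2 - x) + y2 * (x - x1)) / (x2 - x1)"
    using assms by (simp add: l_def divide_simps) (simp add: algebra_simps)?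
  ultimately show ?thesis by simp
qed

lemma line_at:
  fixes x :: real
  assumes "convex C" and "(x1, s * x1 + c) \<in> C" "(x2, s * x2 + c) \<in> C" and "x1 \<le> x" "x \<le> x2"
  shows "(x, s * x + c) \<in> C"
proof (cases "x1 = x2")
  case False
  have "(x, ((s * x1 + c) * (x2 - x) + (s * x2 + c) * (x - x1)) / (x2 - x1)) \<in> C"
    by (rule chord_at) (use assms False in auto)
  moreover have "((s * x1 + c) * (x2 - x) + (s * x2 + c) * (x - x1)) / (x2 - x1) = s * x + c"
    using False by (simp add: divide_simps) (simp add: algebra_simps)
  ultimately show ?thesis by simp
qed (use assms in auto)

lemma crossing_height:
  fixes x1 x2 y :: real
  assumes C: "convex C" and "(x1, y1) \<in> C" "(x2, y2) \<in> C" and "y1 < y" "y < y2"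
  obtains x where "(x, y) \<in> C" "min x1 x2 \<le> x" "x \<le> max x1 x2"
proof -
  define l where "l = (y - y1) / (y2 - y1)"
  have l: "0 \<le> l" "l \<le> 1"
    using assms by (auto simp: l_def field_simps)
  have "(1 - l) *\<^sub>R (x1, y1) + l *\<^sub>R (x2, y2) \<in> C"
    using l by (intro convexD_alt[OF C]) (use assms in auto)
  moreover have "(1 - l) * y1 + l * y2 = y"
    using assms by (simp add: l_def divide_simps) (simp add: algebra_simps)?
  ultimately have "((1 - l) * x1 + l * x2, y) \<in> C" by simp
  moreover have "(1 - l) * x1 + l * x2 \<le> max x1 x2"
    using l by (intro convex_bound_le) auto
  moreover have "- ((1 - l) * x1 + l * x2) \<le> - min x1 x2"
    using l convex_bound_le[of "- x1" "- min x1 x2" "- x2" "1 - l" l] by (auto simp: algebra_simps)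
  ultimately show ?thesis using that by auto
qed

section \<open>Exponents of the vertices of an empty polygon\<close>

text \<open>Only triangles with corners among the vertices are ever tested. Corners may coincide, so
  segments are covered, and \<open>(i, j)\<close> may itself be in \<open>V\<close>, so the
  condition also expresses convex position.\<close>

locale empty_exponents =
  fixes \<alpha> :: real and V :: "(nat \<times> nat) set"
  assumes gt1: "\<alpha> > 1" and fin: "finite V"
    and emptyD: "\<And>a b c d e f i j. \<lbrakk>(a, b) \<in> V; (c, d) \<in> V; (e, f) \<in> V;
      (\<alpha> ^ i, \<alpha> ^ j) \<in> convex hull {(\<alpha> ^ a, \<alpha> ^ b), (\<alpha> ^ c, \<alpha> ^ d), (\<alpha> ^ e, \<alpha> ^ f)}\<rbrakk>
      \<Longrightarrow> (i, j) \<in> {(a, b), (c, d), (e, f)}"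
begin

lemma swap: "empty_exponents \<alpha> (prod.swap ` V)"
proof
  fix a b c d e f i j
  assume in_V: "(a, b) \<in> prod.swap ` V" "(c, d) \<in> prod.swap ` V" "(e, f) \<in> prod.swap ` V"
    and "(\<alpha> ^ i, \<alpha> ^ j) \<in> convex hull {(\<alpha> ^ a, \<alpha> ^ b), (\<alpha> ^ c, \<alpha> ^ d), (\<alpha> ^ e, \<alpha> ^ f)}"
  then have "(\<alpha> ^ j, \<alpha> ^ i) \<in>
      prod.swap ` (convex hull {(\<alpha> ^ a, \<alpha> ^ b), (\<alpha> ^ c, \<alpha> ^ d), (\<alpha> ^ e, \<alpha> ^ f)})"
    by force
  also have "\<dots> = convex hull {(\<alpha> ^ b, \<alpha> ^ a), (\<alpha> ^ d, \<alpha> ^ c), (\<alpha> ^ f, \<alpha> ^ e)}"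
    by (subst convex_hull_linear_image) (auto intro!: linearI)
  finally have "(j, i) \<in> {(b, a), (d, c), (f, e)}"
    using in_V by (intro emptyD) auto
  then show "(i, j) \<in> {(a, b), (c, d), (e, f)}" by auto
qed (use gt1 fin in auto)

lemma pow_le [simp]: "\<alpha> ^ i \<le> \<alpha> ^ j \<longleftrightarrow> i \<le> j"
  using gt1 by simp

lemma pow_less [simp]: "\<alpha> ^ i < \<alpha> ^ j \<longleftrightarrow> i < j"
  using gt1 by simp

lemma pow_pos [simp]: "\<alpha> ^ i > 0"
  using gt1 by simp

lemma pow_nonneg [simp]: "\<alpha> ^ i \<ge> 0"
  using gt1 by simp

lemma no_three_in_column:
  assumes "(i, j1) \<in> V" "(i, j2) \<in> V" "(i, j3) \<in> V" "j1 < j2" "j2 < j3"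
  shows False
proof -
  let ?C = "convex hull {(\<alpha> ^ i, \<alpha> ^ j1), (\<alpha> ^ i, \<alpha> ^ j3), (\<alpha> ^ i, \<alpha> ^ j3)}"
  have "(\<alpha> ^ i, \<alpha> ^ j2) \<in> ?C"
    by (rule vertical_section[of _ _ "\<alpha> ^ j1" "\<alpha> ^ j3"])
      (use assms in \<open>auto intro: hull_inc\<close>)
  from emptyD[OF assms(1,3,3) this] show False
    using assms by auto
qed

lemma card_column_rest:
  assumes "(i, j) \<in> V" "\<And>z. z \<in> V \<Longrightarrow> j \<le> snd z"
  shows "card {z \<in> V. fst z = i \<and> z \<noteq> (i, j)} \<le> 1"
proof -
  have "z = z'" if *: "z \<in> V" "z' \<in> V" "fst z = i" "fst z' = i" "z \<noteq> (i, j)" "z' \<noteq> (i, j)" for z z'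
  proof (rule ccontr)
    assume "z \<noteq> z'"
    then obtain y y' where z: "z = (i, y)" "z' = (i, y')" "y \<noteq> y'"
      using * by (metis prod.exhaust_sel)
    then have "j < y" "j < y'"
      using assms(2)[of z] assms(2)[of z'] * by (simp_all add: order_less_le)
    then show False
      using * z assms(1) no_three_in_column[of i j y y'] no_three_in_column[of i j y' y]
      by (cases y y' rule: linorder_cases) auto
  qed
  then show ?thesis
    using fin by (auto simp: card_le_Suc0_iff_eq)
qed

lemma card_row_rest:
  assumes "(i, j) \<in> V" "\<And>z. z \<in> V \<Longrightarrow> i \<le> fst z"
  shows "card {z \<in> V. snd z = j \<and> z \<noteq> (i, j)} \<le> 1"
proof -
  have "card {z \<in> prod.swap ` V. fst z = j \<and> z \<noteq> (j, i)} \<le> 1"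
    by (rule empty_exponents.card_column_rest[OF swap]) (use assms in force)+
  also have "{z \<in> prod.swap ` V. fst z = j \<and> z \<noteq> (j, i)} =
      prod.swap ` {z \<in> V. snd z = j \<and> z \<noteq> (i, j)}"
    by force
  finally show ?thesis by (simp add: card_image)
qed

text \<open>Otherwise the lattice neighbour of \<open>(a, j)\<close> in its row lies in the triangle of \<open>(a, j)\<close>,
  a top vertex and a bottom vertex.\<close>

lemma left_corner:
  assumes box: "\<And>z. z \<in> V \<Longrightarrow> a \<le> fst z \<and> b \<le> snd z \<and> snd z \<le> B"
    and "(a, j) \<in> V" "(c, b) \<in> V" "(d, B) \<in> V"
  shows "(a, b) \<in> V \<or> (a, B) \<in> V"
proof (rule ccontr)
  assume neg: "\<not> ?thesis"
  have ne: "a \<noteq> c" "a \<noteq> d" "j \<noteq> b" "j \<noteq> B"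
    using neg assms by auto
  moreover have "a \<le> c" "a \<le> d" "b \<le> j" "j \<le> B"
    using box assms by fastforce+
  ultimately have less: "a < c" "a < d" "b < j" "j < B"
    by auto
  let ?C = "convex hull {(\<alpha> ^ a, \<alpha> ^ j), (\<alpha> ^ c, \<alpha> ^ b), (\<alpha> ^ d, \<alpha> ^ B)}"
  \<comment> \<open>The other two corners lie in columns beyond \<open>a\<close>, so the chord of
    the triangle in row \<open>j\<close> reaches from column \<open>a\<close> at least to column
    \<open>a + 1\<close>.\<close>
  obtain x where x: "(x, \<alpha> ^ j) \<in> ?C" "min (\<alpha> ^ c) (\<alpha> ^ d) \<le> x"
    by (rule crossing_height[of ?C "\<alpha> ^ c" "\<alpha> ^ b" "\<alpha> ^ d" "\<alpha> ^ B" "\<alpha> ^ j"])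
      (use less in \<open>auto intro: hull_inc\<close>)
  have "\<alpha> ^ Suc a \<le> x"
    using less by (intro order_trans[OF min.boundedI x(2)]) (simp_all del: power_Suc)
  then have "(\<alpha> ^ Suc a, \<alpha> ^ j) \<in> ?C"
    by - (rule horizontal_section[OF convex_convex_hull hull_inc x(1), of "\<alpha> ^ a"],
      simp_all del: power_Suc)
  from emptyD[OF assms(2-4) this] show False
    using less by auto
qed

text \<open>Mirror image of \<open>left_corner\<close>, with the neighbour
  \<open>(A - 1, j)\<close>; the subtraction is a true predecessor because
  \<open>c < A\<close>.\<close>

lemma right_corner:
  assumes box: "\<And>z. z \<in> V \<Longrightarrow> fst z \<le> A \<and> b \<le> snd z \<and> snd z \<le> B"
    and "(A, j) \<in> V" "(c, b) \<in> V" "(d, B) \<in> V"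
  shows "(A, b) \<in> V \<or> (A, B) \<in> V"
proof (rule ccontr)
  assume neg: "\<not> ?thesis"
  have ne: "A \<noteq> c" "A \<noteq> d" "j \<noteq> b" "j \<noteq> B"
    using neg assms by auto
  moreover have "c \<le> A" "d \<le> A" "b \<le> j" "j \<le> B"
    using box assms by fastforce+
  ultimately have less: "c < A" "d < A" "b < j" "j < B"
    by auto
  let ?C = "convex hull {(\<alpha> ^ A, \<alpha> ^ j), (\<alpha> ^ c, \<alpha> ^ b), (\<alpha> ^ d, \<alpha> ^ B)}"
  obtain x where x: "(x, \<alpha> ^ j) \<in> ?C" "x \<le> max (\<alpha> ^ c) (\<alpha> ^ d)"
    by (rule crossing_height[of ?C "\<alpha> ^ c" "\<alpha> ^ b" "\<alpha> ^ d" "\<alpha> ^ B" "\<alpha> ^ j"])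
      (use less in \<open>auto intro: hull_inc\<close>)
  have "x \<le> \<alpha> ^ (A - 1)"
    using less by (intro order_trans[OF x(2) max.boundedI]) simp_all
  then have "(\<alpha> ^ (A - 1), \<alpha> ^ j) \<in> ?C"
    by - (rule horizontal_section[OF convex_convex_hull x(1) hull_inc, of "\<alpha> ^ A"], simp_all)
  from emptyD[OF assms(2-4) this] show False
    using less by auto
qed

section \<open>The bounding box has antidiagonal corners in the polygon\<close>

text \<open>The bound is 2 + 1 + 1 + (k - 1) + k: the two corners, at most one more vertex each in
  the top row and the right column, and the rest on or above (\<open>N\<close>) or below
  (\<open>S\<close>) the diagonal \<open>y = m * x + n\<close>, at most one per row on either
  side.\<close>

lemma card_antidiagonal:
  assumes k: "\<alpha> \<le> \<alpha> ^ k * (\<alpha> - 1)"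
    and box: "\<And>z. z \<in> V \<Longrightarrow> a \<le> fst z \<and> fst z \<le> A \<and> b \<le> snd z \<and> snd z \<le> B"
    and TL: "(a, B) \<in> V" and BR: "(A, b) \<in> V"
  shows "card V \<le> 2 * k + 3"
proof -
  have k1: "k \<ge> 1"
    using k gt1 by (cases k) auto
  define m where "m = (\<alpha> ^ b - \<alpha> ^ B) / (\<alpha> ^ A - \<alpha> ^ a)"
  define n where "n = \<alpha> ^ B - m * \<alpha> ^ a"
  define N where "N = {(c, d) \<in> V. c < A \<and> d < B \<and> m * \<alpha> ^ c + n \<le> \<alpha> ^ d}"
  define S where "S = {(c, d) \<in> V. c < A \<and> d < B \<and> \<alpha> ^ d < m * \<alpha> ^ c + n}"
  \<comment> \<open>In a degenerate box \<open>m\<close> is meaningless, but then \<open>N\<close>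
    and \<open>S\<close> are empty; hence the facts are conditional on a vertex with
    \<open>c < A\<close> and \<open>d < B\<close>.\<close>
  have *: "a < A" "b < B" "m < 0" "\<alpha> ^ B = m * \<alpha> ^ a + n" "\<alpha> ^ b = m * \<alpha> ^ A + n"
    if "(c, d) \<in> V" "c < A" "d < B" for c d
  proof -
    show "a < A" "b < B" using box[OF that(1)] that by auto
    then show "m < 0" by (simp add: m_def divide_neg_pos)
    show "\<alpha> ^ B = m * \<alpha> ^ a + n" by (simp add: n_def)
    have "m * (\<alpha> ^ A - \<alpha> ^ a) = \<alpha> ^ b - \<alpha> ^ B"
      using \<open>a < A\<close> pow_less[of a A] by (simp add: m_def del: pow_less)
    then show "\<alpha> ^ b = m * \<alpha> ^ A + n" by (simp add: n_def algebra_simps)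
  qed
  \<comment> \<open>Over the box, the diagonal lies above the segment from
    \<open>(0, \<alpha> ^ B)\<close> to \<open>(\<alpha> ^ A, 0)\<close>. At a column
    \<open>c < A\<close> that segment has height at least
    \<open>\<alpha> ^ B * (1 - 1 / \<alpha>)\<close>, which is at least
    \<open>\<alpha> ^ B / \<alpha> ^ k\<close> by the choice of \<open>k\<close>.\<close>
  have above: "B < y + k"
    if q: "(c, d) \<in> V" "c < A" "d < B" and y: "m * \<alpha> ^ c + n \<le> \<alpha> ^ y" for c d y
  proof -
    note * = *[OF q]
    let ?A = "\<alpha> ^ A" and ?B = "\<alpha> ^ B" and ?a = "\<alpha> ^ a" and ?b = "\<alpha> ^ b" and ?x = "\<alpha> ^ c" and ?y = "\<alpha> ^ y"
    have x: "?a \<le> ?x" "?x < ?A"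
      using box[OF q(1)] q by auto
    have D: "?A - ?a > 0" using * by simp
    have "(?A - ?a) * (m * ?x + n) = ?B * (?A - ?a) - (?B - ?b) * (?x - ?a)"
      unfolding *(4,5) by (simp add: algebra_simps)
    moreover have "(?A - ?a) * (m * ?x + n) \<le> (?A - ?a) * ?y"
      using y D by (intro mult_left_mono) auto
    ultimately have 1: "?A * (?B * (?A - ?a) - (?B - ?b) * (?x - ?a)) \<le> ?A * ((?A - ?a) * ?y)"
      by (intro mult_left_mono) auto
    \<comment> \<open>Dropping these two terms replaces the diagonal by the lower segment.\<close>
    have 2: "?a * ?B * (?A - ?x) > 0" "?A * ?b * (?x - ?a) \<ge> 0"
      using x by auto
    have 3: "?A * (?B * (?A - ?a) - (?B - ?b) * (?x - ?a)) =
        (?A - ?a) * (?A * ?B - ?x * ?B) + ?a * ?B * (?A - ?x) + ?A * ?b * (?x - ?a)"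
      by (simp add: algebra_simps)
    have "(?A - ?a) * (?A * ?B - ?x * ?B) < ?A * ((?A - ?a) * ?y)"
      using 1 2 unfolding 3 by linarith
    then have "(?A - ?a) * (?A * ?B - ?x * ?B) < (?A - ?a) * (?A * ?y)"
      by (simp only: mult.left_commute)
    then have 1: "?A * ?B - ?x * ?B < ?A * ?y"
      using D by simp
    have "\<alpha> ^ Suc c \<le> ?A"
      using q by (simp del: power_Suc)
    then have "?A * ?B * (\<alpha> - 1) \<le> ?A * ?B * \<alpha> - \<alpha> * ?x * ?B"
      by (simp add: right_diff_distrib)
    also have "\<dots> = \<alpha> * (?A * ?B - ?x * ?B)"
      by (simp add: algebra_simps)
    also have "\<dots> < \<alpha> * (?A * ?y)"
      using 1 gt1 by simp
    finally have "?A * (?B * (\<alpha> - 1)) < ?A * (\<alpha> * ?y)"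
      by (simp only: mult.assoc mult.left_commute)
    then have "?B * (\<alpha> - 1) < \<alpha> * ?y"
      by simp
    also have "\<dots> \<le> (\<alpha> ^ k * (\<alpha> - 1)) * ?y"
      using k by (intro mult_right_mono) auto
    also have "\<dots> = \<alpha> ^ (y + k) * (\<alpha> - 1)"
      by (simp add: power_add)
    finally show ?thesis
      using gt1 by simp
  qed
  have cross: "\<exists>x. \<alpha> ^ d = m * x + n \<and> (\<forall>c' d'. (x, \<alpha> ^ d) \<in>
      convex hull {(\<alpha> ^ a, \<alpha> ^ B), (\<alpha> ^ c', \<alpha> ^ d'), (\<alpha> ^ A, \<alpha> ^ b)})"
    if q: "(c, d) \<in> V" "c < A" "d < B" for c d
  proof -
    note * = *[OF q]
    define x where "x = (\<alpha> ^ d - n) / m"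
    have x: "\<alpha> ^ d = m * x + n"
      using * by (simp add: x_def)
    have "\<alpha> ^ b \<le> \<alpha> ^ d" "\<alpha> ^ d \<le> \<alpha> ^ B"
      using box[OF q(1)] by simp_all
    then have "m * \<alpha> ^ A \<le> m * x" "m * x \<le> m * \<alpha> ^ a"
      unfolding x *(4,5) by simp_all
    then have "\<alpha> ^ a \<le> x" "x \<le> \<alpha> ^ A"
      by (simp_all only: mult_le_cancel_left_neg[OF *(3)])
    then have "(x, m * x + n) \<in> convex hull {(\<alpha> ^ a, \<alpha> ^ B), (\<alpha> ^ c', \<alpha> ^ d'), (\<alpha> ^ A, \<alpha> ^ b)}" for c' d'
      by - (rule line_at[of _ "\<alpha> ^ a" _ _ "\<alpha> ^ A"], simp_all add: hull_inc flip: *(4,5))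
    then show ?thesis using x by auto
  qed
  \<comment> \<open>Of two vertices in one row on the same side, the one nearer to the diagonal lies
    between the other one and the point from \<open>cross\<close>, hence in a triangle.\<close>
  have injN: False if "(c, d) \<in> N" "(c', d) \<in> N" "c < c'" for c c' d
  proof -
    have q: "(c, d) \<in> V" "c < A" "d < B" and y: "m * \<alpha> ^ c + n \<le> \<alpha> ^ d" and q': "(c', d) \<in> V"
      using that by (auto simp: N_def)
    let ?C = "convex hull {(\<alpha> ^ a, \<alpha> ^ B), (\<alpha> ^ c', \<alpha> ^ d), (\<alpha> ^ A, \<alpha> ^ b)}"
    obtain x where x: "\<alpha> ^ d = m * x + n" "(x, \<alpha> ^ d) \<in> ?C"
      using cross[OF q] by blast
    have "x \<le> \<alpha> ^ c"
      using y x(1) *(3)[OF q] by simp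
    then have "(\<alpha> ^ c, \<alpha> ^ d) \<in> ?C"
      using that by - (rule horizontal_section[OF convex_convex_hull x(2), of "\<alpha> ^ c'"],
        simp_all add: hull_inc)
    from emptyD[OF TL q' BR this] show False
      using q that by auto
  qed
  have injS: False if "(c, d) \<in> S" "(c', d) \<in> S" "c < c'" for c c' d
  proof -
    have q': "(c', d) \<in> V" "c' < A" "d < B" and y: "\<alpha> ^ d < m * \<alpha> ^ c' + n" and q: "(c, d) \<in> V"
      using that by (auto simp: S_def)
    let ?C = "convex hull {(\<alpha> ^ a, \<alpha> ^ B), (\<alpha> ^ c, \<alpha> ^ d), (\<alpha> ^ A, \<alpha> ^ b)}"
    obtain x where x: "\<alpha> ^ d = m * x + n" "(x, \<alpha> ^ d) \<in> ?C"
      using cross[OF q'] by blast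
    have "\<alpha> ^ c' \<le> x"
      using y x(1) *(3)[OF q'] by simp
    then have "(\<alpha> ^ c', \<alpha> ^ d) \<in> ?C"
      using that by - (rule horizontal_section[OF convex_convex_hull _ x(2), of "\<alpha> ^ c"],
        simp_all add: hull_inc)
    from emptyD[OF TL q BR this] show False
      using q' that by auto
  qed
  have finNS: "finite N" "finite S"
    by (rule finite_subset[OF _ fin]; auto simp: N_def S_def)+
  have "card N \<le> card {1..<k}"
  proof (rule card_inj_on_le)
    show "inj_on (\<lambda>z. B - snd z) N"
    proof (rule inj_onI, clarify)
      fix c d c' d' assume z: "(c, d) \<in> N" "(c', d') \<in> N" "B - snd (c, d) = B - snd (c', d')"
      then have "d = d'" by (auto simp: N_def)
      then show "c = c' \<and> d = d'" using z injN by (metis linorder_neqE_nat)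
    qed
    show "(\<lambda>z. B - snd z) ` N \<subseteq> {1..<k}"
      using above by (fastforce simp: N_def)
  qed simp
  moreover have "card S \<le> card {1..k}"
  proof (rule card_inj_on_le)
    show "inj_on (\<lambda>z. B - snd z) S"
    proof (rule inj_onI, clarify)
      fix c d c' d' assume z: "(c, d) \<in> S" "(c', d') \<in> S" "B - snd (c, d) = B - snd (c', d')"
      then have "d = d'" by (auto simp: S_def)
      then show "c = c' \<and> d = d'" using z injS by (metis linorder_neqE_nat)
    qed
    \<comment> \<open>The neighbour \<open>(c, d + 1)\<close> cannot be strictly below the diagonal,
      since it would lie in the triangle. So \<open>above\<close> applies to it instead of
      \<open>(c, d)\<close>, which costs one row compared with \<open>N\<close>.\<close>
    have "B - d \<le> k" if "(c, d) \<in> S" for c d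
    proof (rule ccontr)
      assume neg: "\<not> B - d \<le> k"
      have q: "(c, d) \<in> V" "c < A" "d < B" and y: "\<alpha> ^ d < m * \<alpha> ^ c + n"
        using that by (auto simp: S_def)
      note * = *[OF q]
      have "\<not> m * \<alpha> ^ c + n \<le> \<alpha> ^ Suc d"
        using above[OF q, of "Suc d"] neg by auto
      let ?C = "convex hull {(\<alpha> ^ a, \<alpha> ^ B), (\<alpha> ^ c, \<alpha> ^ d), (\<alpha> ^ A, \<alpha> ^ b)}"
      have "(\<alpha> ^ c, m * \<alpha> ^ c + n) \<in> ?C"
        by (rule line_at[of _ "\<alpha> ^ a" _ _ "\<alpha> ^ A"])
          (use box[OF q(1)] in \<open>simp_all add: hull_inc flip: *(4,5)\<close>)
      then have "(\<alpha> ^ c, \<alpha> ^ Suc d) \<in> ?C"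
        using \<open>\<not> m * \<alpha> ^ c + n \<le> \<alpha> ^ Suc d\<close>
        by - (rule vertical_section[of ?C _ "\<alpha> ^ d" "m * \<alpha> ^ c + n"],
          simp_all add: hull_inc del: power_Suc)
      from emptyD[OF TL q(1) BR this] show False
        using q neg k1 by auto
    qed
    then show "(\<lambda>z. B - snd z) ` S \<subseteq> {1..k}"
      by (fastforce simp: S_def)
  qed simp
  moreover
  define T where "T = {z \<in> V. snd z = B \<and> z \<noteq> (a, B)}"
  define R where "R = {z \<in> V. fst z = A \<and> z \<noteq> (A, b)}"
  have "card T \<le> 1"
    unfolding T_def by (rule card_row_rest[OF TL]) (use box in auto)
  moreover have "card R \<le> 1"
    unfolding R_def by (rule card_column_rest[OF BR]) (use box in auto)
  moreover have "card V \<le> card ({(a, B), (A, b)} \<union> T \<union> R \<union> N \<union> S)"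
  proof (rule card_mono)
    show "finite ({(a, B), (A, b)} \<union> T \<union> R \<union> N \<union> S)"
      using finNS fin by (auto simp: T_def R_def)
    show "V \<subseteq> {(a, B), (A, b)} \<union> T \<union> R \<union> N \<union> S"
      using box by (fastforce simp: T_def R_def N_def S_def)
  qed
  moreover have "card ({(a, B), (A, b)} \<union> T \<union> R \<union> N \<union> S) \<le> 2 + card T + card R + card N + card S"
    by (intro card_Un_le[THEN order_trans] add_mono order_refl) (simp add: card_insert_le_m1)
  ultimately show ?thesis
    using k1 by simp
qed

end

section \<open>The bounding box has diagonal corners in the polygon\<close>

text \<open>\<open>y = s * x - t\<close> is the line through the two corners. Since \<open>c - d\<close> determines the ray
  from the origin through \<open>(\<alpha> ^ c, \<alpha> ^ d)\<close>, the vertices below and above this line are counted by \<open>c - d\<close>,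
  compared with its value \<open>A - B\<close> at the upper corner.\<close>

locale steep_diagonal = empty_exponents +
  fixes a b A B k :: nat and s t :: real
  assumes k: "\<alpha> \<le> \<alpha> ^ k * (\<alpha> - 1)"
    and box: "(c, d) \<in> V \<Longrightarrow> a \<le> c \<and> c \<le> A \<and> b \<le> d \<and> d \<le> B"
    and P: "(a, b) \<in> V" and R: "(A, B) \<in> V"
    and aA: "a < A" and steep: "A + b < B + a"
    and lineP: "\<alpha> ^ b = s * \<alpha> ^ a - t" and lineR: "\<alpha> ^ B = s * \<alpha> ^ A - t"
begin

abbreviation below :: "nat \<Rightarrow> nat \<Rightarrow> bool" where
  "below c d \<equiv> \<alpha> ^ d < s * \<alpha> ^ c - t"

abbreviation above :: "nat \<Rightarrow> nat \<Rightarrow> bool" where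
  "above c d \<equiv> s * \<alpha> ^ c - t < \<alpha> ^ d"

section \<open>Signs of the coefficients of the diagonal\<close>

lemma bB: "b < B"
  using steep aA by simp

text \<open>By \<open>steep\<close>, the upper corner is on a steeper ray from the origin than the
  lower one, so the line through both passes below the origin.\<close>

lemma t_pos: "t > 0"
proof -
  have "t * (\<alpha> ^ A - \<alpha> ^ a) = \<alpha> ^ B * \<alpha> ^ a - \<alpha> ^ b * \<alpha> ^ A"
    unfolding lineP lineR by (simp add: algebra_simps)
  also have "\<dots> = \<alpha> ^ (B + a) - \<alpha> ^ (A + b)"
    by (simp add: power_add)
  also have "\<dots> > 0"
    using steep by (simp del: add_less_cancel_left)
  finally show ?thesis
    using aA by (simp add: zero_less_mult_iff)
qed

lemma s_pos: "s > 0"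
proof -
  have "s * \<alpha> ^ a > 0"
    using lineP t_pos pow_pos[of b] by linarith
  then show ?thesis
    by (rule zero_less_mult_pos2) simp
qed

lemma slope_le: "s * \<alpha> ^ i \<le> s * \<alpha> ^ j \<longleftrightarrow> i \<le> j"
  using s_pos by simp

section \<open>Triangles with the diagonal as an edge\<close>

lemma diagonal_point:
  assumes "a \<le> i" "i \<le> A"
  shows "(\<alpha> ^ i, s * \<alpha> ^ i - t) \<in> convex hull {(\<alpha> ^ a, \<alpha> ^ b), (\<alpha> ^ c, \<alpha> ^ d), (\<alpha> ^ A, \<alpha> ^ B)}"
proof -
  have "(\<alpha> ^ i, s * \<alpha> ^ i + (- t)) \<in> convex hull {(\<alpha> ^ a, \<alpha> ^ b), (\<alpha> ^ c, \<alpha> ^ d), (\<alpha> ^ A, \<alpha> ^ B)}"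
    by (rule line_at[of _ "\<alpha> ^ a" _ _ "\<alpha> ^ A"])
      (use assms lineP lineR in \<open>simp_all add: hull_inc\<close>)
  then show ?thesis by simp
qed

lemma no_point_on_diagonal:
  assumes "(c, d) \<in> V" "\<alpha> ^ d = s * \<alpha> ^ c - t"
  shows "(c, d) \<in> {(a, b), (A, B)}"
  using emptyD[OF P P R, of c d] diagonal_point[of c a b] box[OF assms(1)] assms(2) by auto

text \<open>The last two premises place the point under the diagonal and over the chord from the
  lower corner to \<open>(c, d)\<close>; the chord condition is cleared of denominators.\<close>

lemma between_below:
  assumes "(c, d) \<in> V" "a < c" "a \<le> i" "i \<le> c"
    and "\<alpha> ^ j \<le> s * \<alpha> ^ i - t"
    and "\<alpha> ^ b * (\<alpha> ^ c - \<alpha> ^ i) + \<alpha> ^ d * (\<alpha> ^ i - \<alpha> ^ a) \<le> \<alpha> ^ j * (\<alpha> ^ c - \<alpha> ^ a)"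
  shows "(i, j) \<in> {(a, b), (c, d), (A, B)}"
proof -
  let ?C = "convex hull {(\<alpha> ^ a, \<alpha> ^ b), (\<alpha> ^ c, \<alpha> ^ d), (\<alpha> ^ A, \<alpha> ^ B)}"
  have pos: "\<alpha> ^ c - \<alpha> ^ a > 0"
    using assms(2) by simp
  have "(\<alpha> ^ i, (\<alpha> ^ b * (\<alpha> ^ c - \<alpha> ^ i) + \<alpha> ^ d * (\<alpha> ^ i - \<alpha> ^ a)) / (\<alpha> ^ c - \<alpha> ^ a)) \<in> ?C"
    by (rule chord_at) (use assms(2-4) in \<open>simp_all add: hull_inc\<close>)
  moreover have "(\<alpha> ^ i, s * \<alpha> ^ i - t) \<in> ?C"
    using assms(2-4) box[OF assms(1)] by (intro diagonal_point) auto
  moreover have "(\<alpha> ^ b * (\<alpha> ^ c - \<alpha> ^ i) + \<alpha> ^ d * (\<alpha> ^ i - \<alpha> ^ a)) / (\<alpha> ^ c - \<alpha> ^ a) \<le> \<alpha> ^ j"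
    using assms(6) unfolding pos_divide_le_eq[OF pos] .
  ultimately have "(\<alpha> ^ i, \<alpha> ^ j) \<in> ?C"
    using assms(5) by - (rule vertical_section[OF convex_convex_hull])
  from emptyD[OF P assms(1) R this] show ?thesis .
qed

text \<open>Counterpart for a vertex above the diagonal, with the chord from \<open>(c, d)\<close>
  to the upper corner.\<close>

lemma between_above:
  assumes "(c, d) \<in> V" "c < A" "c \<le> i" "i \<le> A"
    and "s * \<alpha> ^ i - t \<le> \<alpha> ^ j"
    and "\<alpha> ^ j * (\<alpha> ^ A - \<alpha> ^ c) \<le> \<alpha> ^ d * (\<alpha> ^ A - \<alpha> ^ i) + \<alpha> ^ B * (\<alpha> ^ i - \<alpha> ^ c)"
  shows "(i, j) \<in> {(a, b), (c, d), (A, B)}"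
proof -
  let ?C = "convex hull {(\<alpha> ^ a, \<alpha> ^ b), (\<alpha> ^ c, \<alpha> ^ d), (\<alpha> ^ A, \<alpha> ^ B)}"
  have pos: "\<alpha> ^ A - \<alpha> ^ c > 0"
    using assms(2) by simp
  have "(\<alpha> ^ i, (\<alpha> ^ d * (\<alpha> ^ A - \<alpha> ^ i) + \<alpha> ^ B * (\<alpha> ^ i - \<alpha> ^ c)) / (\<alpha> ^ A - \<alpha> ^ c)) \<in> ?C"
    by (rule chord_at) (use assms(2-4) in \<open>simp_all add: hull_inc\<close>)
  moreover have "(\<alpha> ^ i, s * \<alpha> ^ i - t) \<in> ?C"
    using assms(2-4) box[OF assms(1)] by (intro diagonal_point) auto
  moreover have "\<alpha> ^ j \<le> (\<alpha> ^ d * (\<alpha> ^ A - \<alpha> ^ i) + \<alpha> ^ B * (\<alpha> ^ i - \<alpha> ^ c)) / (\<alpha> ^ A - \<alpha> ^ c)"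
    using assms(6) unfolding pos_le_divide_eq[OF pos] .
  ultimately have "(\<alpha> ^ i, \<alpha> ^ j) \<in> ?C"
    using assms(5) by - (rule vertical_section[OF convex_convex_hull, of _ "s * \<alpha> ^ i - t"])
  from emptyD[OF P assms(1) R this] show ?thesis .
qed

text \<open>The line is already positive at column \<open>a\<close>. So at later columns subtracting
  \<open>t\<close> leaves more than the fraction \<open>1 - 1 / \<alpha>\<close> of
  \<open>s * \<alpha> ^ c\<close>.\<close>

lemma t_less:
  assumes "a < c"
  shows "\<alpha> * t < s * \<alpha> ^ c"
proof -
  have "t < s * \<alpha> ^ a"
    using lineP pow_pos[of b] by linarith
  then have "\<alpha> * t < s * \<alpha> ^ Suc a"
    using gt1 by (simp add: algebra_simps)
  also have "\<dots> \<le> s * \<alpha> ^ c"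
    unfolding slope_le using assms by simp
  finally show ?thesis .
qed

text \<open>Turns a height estimate into a bound on \<open>c - d\<close>: the slope \<open>s\<close>
  exceeds the ratio of \<open>\<alpha> ^ B\<close> to \<open>\<alpha> ^ A\<close> because
  \<open>t > 0\<close>, and \<open>k\<close> absorbs the factor
  \<open>\<alpha> / (\<alpha> - 1)\<close>. It is used with \<open>j = 1\<close> below and
  \<open>j = 0\<close> above the diagonal.\<close>

lemma exponent_le:
  assumes "s * \<alpha> ^ c * (\<alpha> - 1) < \<alpha> ^ Suc j * \<alpha> ^ d"
  shows "c + B < j + k + (A + d)"
proof -
  have "\<alpha> ^ B < s * \<alpha> ^ A"
    using lineR t_pos by simp
  then have "\<alpha> ^ c * (\<alpha> - 1) * \<alpha> ^ B \<le> \<alpha> ^ c * (\<alpha> - 1) * (s * \<alpha> ^ A)"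
    using gt1 by (intro mult_left_mono) auto
  also have "\<dots> = s * \<alpha> ^ c * (\<alpha> - 1) * \<alpha> ^ A"
    by simp
  also have "\<dots> < \<alpha> ^ Suc j * \<alpha> ^ d * \<alpha> ^ A"
    using assms by (intro mult_strict_right_mono) auto
  also have "\<dots> = \<alpha> ^ (j + (A + d)) * \<alpha>"
    by (simp add: power_add)
  also have "\<dots> \<le> \<alpha> ^ (j + (A + d)) * (\<alpha> ^ k * (\<alpha> - 1))"
    using k by (intro mult_left_mono) auto
  finally have "\<alpha> ^ (c + B) * (\<alpha> - 1) < \<alpha> ^ (j + k + (A + d)) * (\<alpha> - 1)"
    by (simp add: power_add mult_ac)
  then show ?thesis
    using gt1 by (simp del: add_less_cancel_left)
qed

subsection \<open>Vertices below the diagonal\<close>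

lemma below_bounds:
  assumes "(c, d) \<in> V" "below c d"
  shows "a < c" "d < B"
proof -
  have "c \<noteq> a" "d \<noteq> B"
    using assms box[OF assms(1)] lineP lineR slope_le[of c A] pow_le[of b d]
    by (auto simp del: pow_le)
  then show "a < c" "d < B"
    using box[OF assms(1)] by auto
qed

text \<open>Otherwise \<open>(a + 1, b + 1)\<close> lies in the triangle of the two corners and \<open>(c, d)\<close>.\<close>

lemma below_steep:
  assumes "(c, d) \<in> V" "below c d"
  shows "c + b \<le> d + a"
proof (rule ccontr)
  assume neg: "\<not> ?thesis"
  have ac: "a < c" using below_bounds[OF assms] by simp
  have "\<alpha> ^ (d + a) \<le> \<alpha> ^ (c + b)"
    using neg by (simp del: add_le_cancel_left)
  then have "(\<alpha> - 1) * (\<alpha> ^ d * \<alpha> ^ a) \<le> (\<alpha> - 1) * (\<alpha> ^ b * \<alpha> ^ c)"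
    using gt1 by (intro mult_left_mono) (auto simp: power_add mult_ac)
  then have "\<alpha> ^ b * (\<alpha> ^ c - \<alpha> ^ Suc a) + \<alpha> ^ d * (\<alpha> ^ Suc a - \<alpha> ^ a) \<le>
      \<alpha> ^ Suc b * (\<alpha> ^ c - \<alpha> ^ a)"
    by (simp add: algebra_simps)
  \<comment> \<open>Scaling the lower corner by \<alpha> moves it to the line
    \<open>y = s * x - \<alpha> * t\<close>, which is below the diagonal as
    \<open>t > 0\<close>.\<close>
  moreover have "\<alpha> ^ Suc b \<le> s * \<alpha> ^ Suc a - t"
  proof -
    have "1 * t \<le> \<alpha> * t"
      using gt1 t_pos by (intro mult_right_mono) auto
    then show ?thesis
      unfolding power_Suc lineP by (simp add: algebra_simps)
  qed
  ultimately have "(Suc a, Suc b) \<in> {(a, b), (c, d), (A, B)}"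
    using ac by (intro between_below assms) auto
  then show False
    using neg steep by auto
qed

text \<open>Otherwise \<open>(c - 1, d - 1)\<close>, the vertex scaled down by \<alpha>, is still
  below the diagonal, and by \<open>below_steep\<close> it is not under the chord to the lower
  corner. So these vertices lie in the strip where \<open>s * x - y\<close> is between
  \<open>t\<close> and \<open>\<alpha> * t\<close>.\<close>

lemma below_scaled:
  assumes "(c, d) \<in> V" "below c d"
  shows "s * \<alpha> ^ c - \<alpha> * t \<le> \<alpha> ^ d"
proof (rule ccontr)
  assume neg: "\<not> ?thesis"
  have st: "c + b \<le> d + a" and ac: "a < c" and dB: "d < B"
    using below_steep below_bounds assms by auto
  obtain c' d' where [simp]: "c = Suc c'" "d = Suc d'"
    using ac st box[OF assms(1)] by (cases c; cases d) auto
  have "\<alpha> * \<alpha> ^ d' < \<alpha> * (s * \<alpha> ^ c' - t)"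
    using neg by (simp add: algebra_simps)
  then have less: "\<alpha> ^ d' < s * \<alpha> ^ c' - t"
    using gt1 by simp
  have "\<alpha> ^ (b + c') \<le> \<alpha> ^ (d' + a)"
    using st by (simp del: add_le_cancel_left)
  then have "(\<alpha> - 1) * (\<alpha> ^ b * \<alpha> ^ c') \<le> (\<alpha> - 1) * (\<alpha> ^ d' * \<alpha> ^ a)"
    using gt1 by (intro mult_left_mono) (auto simp: power_add mult_ac)
  then have "\<alpha> ^ b * (\<alpha> ^ c - \<alpha> ^ c') + \<alpha> ^ d * (\<alpha> ^ c' - \<alpha> ^ a) \<le> \<alpha> ^ d' * (\<alpha> ^ c - \<alpha> ^ a)"
    by (simp add: algebra_simps)
  then have "(c', d') \<in> {(a, b), (c, d), (A, B)}"
    using ac less by (intro between_below assms) auto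
  then show False
    using less dB lineP by auto
qed

lemma below_range:
  assumes "(c, d) \<in> V" "below c d"
  shows "A + d < c + B" "c + B \<le> k + (A + d)"
proof -
  note q = box[OF assms(1)] below_bounds[OF assms]
  \<comment> \<open>Otherwise the neighbour \<open>(c, d + 1)\<close> lies between
    \<open>(c, d)\<close> and the diagonal.\<close>
  have up: "s * \<alpha> ^ c - t \<le> \<alpha> ^ Suc d"
  proof (rule ccontr)
    assume neg: "\<not> ?thesis"
    let ?C = "convex hull {(\<alpha> ^ a, \<alpha> ^ b), (\<alpha> ^ c, \<alpha> ^ d), (\<alpha> ^ A, \<alpha> ^ B)}"
    have "(\<alpha> ^ c, s * \<alpha> ^ c - t) \<in> ?C"
      using q by (intro diagonal_point) auto
    then have "(\<alpha> ^ c, \<alpha> ^ Suc d) \<in> ?C"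
      using neg by - (rule vertical_section[OF convex_convex_hull, of _ "\<alpha> ^ d" _ "s * \<alpha> ^ c - t"],
        simp_all add: hull_inc del: power_Suc)
    from emptyD[OF P assms(1) R this] show False
      using neg q lineR by auto
  qed
  have "\<alpha> * (s * \<alpha> ^ c - t) \<le> \<alpha> * \<alpha> ^ Suc d"
    using up gt1 by (intro mult_left_mono) auto
  then have "s * \<alpha> ^ c * (\<alpha> - 1) < \<alpha> ^ Suc 1 * \<alpha> ^ d"
    using t_less[OF below_bounds(1)[OF assms]] by (simp add: algebra_simps)
  from exponent_le[OF this] show "c + B \<le> k + (A + d)"
    by simp
  \<comment> \<open>Up to column \<open>A\<close> the diagonal does not exceed the ray from the
    origin to the upper corner, so \<open>(c, d)\<close> is strictly below this ray.\<close>
  have "0 \<le> t * (\<alpha> ^ A - \<alpha> ^ c)"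
    using t_pos q by simp
  also have "\<dots> = \<alpha> ^ c * (s * \<alpha> ^ A - t) - (s * \<alpha> ^ c - t) * \<alpha> ^ A"
    by (simp add: algebra_simps)
  also have "\<dots> < \<alpha> ^ c * \<alpha> ^ B - \<alpha> ^ d * \<alpha> ^ A"
    using assms(2) lineR by simp
  finally have "\<alpha> ^ (A + d) < \<alpha> ^ (c + B)"
    by (simp add: power_add mult_ac)
  then show "A + d < c + B"
    by (simp only: pow_less)
qed

text \<open>The form \<open>s * x - y\<close> is homogeneous, and on a common ray the farther
  lattice point is the nearer one scaled by at least \<alpha>.\<close>

lemma scale_gap:
  assumes "c < c'" "c + d' = c' + d" and "s * \<alpha> ^ c - \<alpha> ^ d > 0"
  shows "s * \<alpha> ^ c' - \<alpha> ^ d' \<ge> \<alpha> * (s * \<alpha> ^ c - \<alpha> ^ d)"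
proof -
  obtain j where j: "c' = c + Suc j" "d' = d + Suc j"
    using assms less_iff_Suc_add[of c c'] by auto
  have "s * \<alpha> ^ c' - \<alpha> ^ d' = \<alpha> ^ Suc j * (s * \<alpha> ^ c - \<alpha> ^ d)"
    unfolding j by (simp add: power_add algebra_simps)
  moreover have "\<alpha> ^ 1 \<le> \<alpha> ^ Suc j"
    by (simp only: pow_le)
  ultimately show ?thesis
    using assms(3) by (metis less_eq_real_def mult_right_mono power_one_right)
qed

text \<open>The strip from \<open>below_scaled\<close> is too narrow for two lattice points of one
  ray: the farther one would have \<open>s * x - y\<close> greater than
  \<open>\<alpha> * t\<close>.\<close>

lemma below_inj:
  assumes "(c, d) \<in> V" "below c d" "(c', d') \<in> V" "below c' d'" "c + d' = c' + d"
  shows "\<not> c < c'"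
proof
  assume "c < c'"
  have gap: "t < s * \<alpha> ^ c - \<alpha> ^ d"
    using assms(2) by simp
  have "\<alpha> * t < \<alpha> * (s * \<alpha> ^ c - \<alpha> ^ d)"
    using gap gt1 by simp
  also have "\<dots> \<le> s * \<alpha> ^ c' - \<alpha> ^ d'"
    using gap t_pos by (intro scale_gap \<open>c < c'\<close> assms(5)) auto
  also have "\<dots> \<le> \<alpha> * t"
    using below_scaled[OF assms(3,4)] by simp
  finally show False by simp
qed

lemma card_below: "card {(c, d) \<in> V. below c d} \<le> k"
proof -
  have "card {(c, d) \<in> V. below c d} \<le> card {1..k}"
  proof (rule card_inj_on_le)
    show "inj_on (\<lambda>(c, d). c + B - (A + d)) {(c, d) \<in> V. below c d}"
    proof (rule inj_onI, clarsimp)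
      fix c d c' d' assume q: "(c, d) \<in> V" "below c d" "(c', d') \<in> V" "below c' d'"
        and eq: "c + B - (A + d) = c' + B - (A + d')"
      have "c + d' = c' + d"
        using eq below_range[OF q(1,2)] below_range[OF q(3,4)] by simp
      then show "c = c' \<and> d = d'"
        using below_inj[OF q] below_inj[OF q(3,4,1,2)] by auto
    qed
    show "(\<lambda>(c, d). c + B - (A + d)) ` {(c, d) \<in> V. below c d} \<subseteq> {1..k}"
      using below_range by fastforce
  qed simp
  then show ?thesis by simp
qed

subsection \<open>Vertices above the diagonal\<close>

lemma above_bounds:
  assumes "(c, d) \<in> V" "above c d"
  shows "c < A"
proof -
  have "c \<noteq> A"
    using assms box[OF assms(1)] lineR pow_le[of d B] by (auto simp del: pow_le)
  then show ?thesis
    using box[OF assms(1)] by auto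
qed

text \<open>\<open>(A - 1, B - 1)\<close> lies on the ray from the origin to the upper corner, hence in the triangle of the
  two corners and \<open>(c, d)\<close> if \<open>(c, d)\<close> is on or above this ray.\<close>

lemma above_flat:
  assumes "(c, d) \<in> V" "above c d" "c + B \<le> A + d"
  shows "(c, d) = (A - 1, B - 1)"
proof -
  have cA: "c < A" using above_bounds assms by simp
  obtain A' B' where [simp]: "A = Suc A'" "B = Suc B'"
    using aA bB by (cases A; cases B) auto
  have "\<alpha> ^ (c + B') \<le> \<alpha> ^ (A' + d)"
    using assms(3) by (simp del: add_le_cancel_left)
  then have "(\<alpha> - 1) * (\<alpha> ^ c * \<alpha> ^ B') \<le> (\<alpha> - 1) * (\<alpha> ^ A' * \<alpha> ^ d)"
    using gt1 by (intro mult_left_mono) (auto simp: power_add)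
  then have "\<alpha> ^ B' * (\<alpha> ^ A - \<alpha> ^ c) \<le> \<alpha> ^ d * (\<alpha> ^ A - \<alpha> ^ A') + \<alpha> ^ B * (\<alpha> ^ A' - \<alpha> ^ c)"
    by (simp add: algebra_simps)
  \<comment> \<open>Scaling the upper corner down by \<alpha> moves it to the line
    \<open>y = s * x - t / \<alpha>\<close>, which is above the diagonal.\<close>
  moreover have "s * \<alpha> ^ A' - t \<le> \<alpha> ^ B'"
  proof -
    have "1 * t \<le> \<alpha> * t"
      using gt1 t_pos by (intro mult_right_mono) auto
    then have "\<alpha> * (s * \<alpha> ^ A' - t) \<le> \<alpha> * \<alpha> ^ B'"
      using lineR by (simp add: algebra_simps)
    then show ?thesis
      using gt1 by simp
  qed
  ultimately have "(A', B') \<in> {(a, b), (c, d), (A, B)}"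
    using cA by (intro between_above assms(1)) auto
  then show ?thesis
    using steep by auto
qed

text \<open>Otherwise \<open>(c + 1, d + 1)\<close> is on or above the diagonal, and it is not over
  the chord to the upper corner because \<open>(c, d)\<close> is below the ray through that corner.
  So \<open>s * x - y\<close> exceeds \<open>t / \<alpha>\<close>, while \<open>above\<close> keeps
  it less than \<open>t\<close>.\<close>

lemma above_scaled:
  assumes "(c, d) \<in> V" "above c d" "A + d < c + B"
  shows "t < \<alpha> * (s * \<alpha> ^ c - \<alpha> ^ d)"
proof (rule ccontr)
  assume "\<not> ?thesis"
  then have le: "s * \<alpha> ^ Suc c - t \<le> \<alpha> ^ Suc d"
    by (simp add: algebra_simps)
  have cA: "c < A" using above_bounds assms by simp
  have "\<alpha> ^ (A + d) \<le> \<alpha> ^ (c + B)"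
    using assms(3) by (simp del: add_le_cancel_left)
  then have "(\<alpha> - 1) * (\<alpha> ^ A * \<alpha> ^ d) \<le> (\<alpha> - 1) * (\<alpha> ^ c * \<alpha> ^ B)"
    using gt1 by (intro mult_left_mono) (auto simp: power_add)
  then have "\<alpha> ^ Suc d * (\<alpha> ^ A - \<alpha> ^ c) \<le> \<alpha> ^ d * (\<alpha> ^ A - \<alpha> ^ Suc c) + \<alpha> ^ B * (\<alpha> ^ Suc c - \<alpha> ^ c)"
    by (simp add: algebra_simps)
  then have "(Suc c, Suc d) \<in> {(a, b), (c, d), (A, B)}"
    using cA le by (intro between_above assms(1)) auto
  then show False
    using assms(3) box[OF assms(1)] by auto
qed

text \<open>The vertex itself, not its upper neighbour, is above the line, which saves one value
  compared with \<open>below_range\<close>. Column \<open>a\<close> is left out because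
  \<open>t_less\<close> fails to apply there.\<close>

lemma above_range:
  assumes "(c, d) \<in> V" "above c d" "a < c"
  shows "c + B < k + (A + d)"
proof -
  have "\<alpha> * (s * \<alpha> ^ c - t) < \<alpha> * \<alpha> ^ d"
    using assms(2) gt1 by simp
  then have "s * \<alpha> ^ c * (\<alpha> - 1) < \<alpha> ^ Suc 0 * \<alpha> ^ d"
    using t_less[OF assms(3)] by (simp add: algebra_simps)
  from exponent_le[OF this] show ?thesis
    by simp
qed

lemma above_inj:
  assumes "(c, d) \<in> V" "above c d" "A + d < c + B" "(c', d') \<in> V" "above c' d'" "c + d' = c' + d"
  shows "\<not> c < c'"
proof
  assume "c < c'"
  have gap: "t < \<alpha> * (s * \<alpha> ^ c - \<alpha> ^ d)"
    by (rule above_scaled[OF assms(1-3)])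
  then have "0 < \<alpha> * (s * \<alpha> ^ c - \<alpha> ^ d)"
    using t_pos by linarith
  then have "0 < s * \<alpha> ^ c - \<alpha> ^ d"
    using gt1 by (simp add: zero_less_mult_iff)
  then have "\<alpha> * (s * \<alpha> ^ c - \<alpha> ^ d) \<le> s * \<alpha> ^ c' - \<alpha> ^ d'"
    by (intro scale_gap \<open>c < c'\<close> assms(6))
  then show False
    using gap assms(5) by linarith
qed

lemma card_above_right:
  "card {(c, d) \<in> V. above c d \<and> A + d < c + B \<and> a < c} \<le> card {1..<k}" (is "card ?N \<le> _")
proof (rule card_inj_on_le)
  show "inj_on (\<lambda>(c, d). c + B - (A + d)) ?N"
  proof (rule inj_onI, clarsimp)
    fix c d c' d' assume q: "(c, d) \<in> V" "above c d" "A + d < c + B"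
      and q': "(c', d') \<in> V" "above c' d'" "A + d' < c' + B"
      and eq: "c + B - (A + d) = c' + B - (A + d')"
    have "c + d' = c' + d"
      using eq q q' by simp
    then show "c = c' \<and> d = d'"
      using above_inj[OF q q'(1,2)] above_inj[OF q' q(1,2)] by auto
  qed
  show "(\<lambda>(c, d). c + B - (A + d)) ` ?N \<subseteq> {1..<k}"
    using above_range by fastforce
qed simp

text \<open>The bound is 3 + 1 + (k - 1) + k: the corners with the exceptional point of
  \<open>above_flat\<close>, the rest of column \<open>a\<close>, and the vertices counted by rays
  above and below the diagonal.\<close>

lemma card_diagonal: "card V \<le> 2 * k + 3"
proof -
  have k1: "k \<ge> 1"
    using k gt1 by (cases k) auto
  define S where "S = {(c, d) \<in> V. below c d}"
  define N where "N = {(c, d) \<in> V. above c d \<and> A + d < c + B \<and> a < c}"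
  define L where "L = {z \<in> V. fst z = a \<and> z \<noteq> (a, b)}"
  let ?E = "{(a, b), (A, B), (A - 1, B - 1)}"
  have "card L \<le> 1"
    unfolding L_def by (rule card_column_rest[OF P]) (use box in auto)
  moreover have "card S \<le> k"
    unfolding S_def by (rule card_below)
  moreover have "card N \<le> k - 1"
    using card_above_right by (simp add: N_def)
  moreover have "card V \<le> card (?E \<union> L \<union> N \<union> S)"
  proof (rule card_mono)
    show "finite (?E \<union> L \<union> N \<union> S)"
      by (intro finite_UnI; rule finite_subset[OF _ fin] finite.intros)
        (auto simp: L_def N_def S_def)
    show "V \<subseteq> ?E \<union> L \<union> N \<union> S"
    proof
      fix z assume "z \<in> V"
      moreover obtain c d where [simp]: "z = (c, d)" by (cases z)
      ultimately have q: "(c, d) \<in> V" by simp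
      consider "below c d" | "\<alpha> ^ d = s * \<alpha> ^ c - t" | "above c d" by linarith
      then show "z \<in> ?E \<union> L \<union> N \<union> S"
      proof cases
        case 1
        then show ?thesis using q by (simp add: S_def)
      next
        case 2
        then show ?thesis using no_point_on_diagonal[OF q] by auto
      next
        case 3
        show ?thesis
        proof (cases "c + B \<le> A + d")
          case True
          then show ?thesis using above_flat[OF q 3] by simp
        next
          case False
          then have "(c, d) \<in> N" if "c \<noteq> a"
            using that 3 q box[OF q] by (simp add: N_def)
          moreover have "(c, d) \<in> L \<union> ?E" if "c = a"
            using that q by (auto simp: L_def)
          ultimately show ?thesis by auto
        qed
      qed
    qed
  qed
  moreover have "card (?E \<union> L \<union> N \<union> S) \<le> 3 + card L + card N + card S"
    by (intro card_Un_le[THEN order_trans] add_mono order_refl) (simp add: card_insert_le_m1)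
  ultimately show ?thesis
    using k1 by simp
qed

end

section \<open>Counting the vertices\<close>

context empty_exponents
begin

lemma card_diagonal_steep:
  assumes k: "\<alpha> \<le> \<alpha> ^ k * (\<alpha> - 1)"
    and box: "\<And>z. z \<in> V \<Longrightarrow> a \<le> fst z \<and> fst z \<le> A \<and> b \<le> snd z \<and> snd z \<le> B"
    and P: "(a, b) \<in> V" and R: "(A, B) \<in> V" and steep: "A + b \<le> B + a"
  shows "card V \<le> 2 * k + 3"
proof -
  have le: "a \<le> A" "b \<le> B"
    using box[OF R] by auto
  consider "a = A" | "a < A" "A + b = B + a" | "a < A" "A + b < B + a"
    using le steep by linarith
  then show ?thesis
  proof cases
    case 1
    \<comment> \<open>In a box of one column, diagonal and antidiagonal corners coincide.\<close>
    show ?thesis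
      by (rule card_antidiagonal[OF k box]) (use P R 1 in simp_all)
  next
    case 2
    have k1: "k \<ge> 1"
      using k gt1 by (cases k) auto
    define r where "r = \<alpha> ^ B / \<alpha> ^ A"
    have "\<alpha> ^ A * \<alpha> ^ b = \<alpha> ^ B * \<alpha> ^ a"
      using 2 by (simp flip: power_add)
    then have r: "\<alpha> ^ b = r * \<alpha> ^ a" "\<alpha> ^ B = r * \<alpha> ^ A"
      using gt1 by (simp_all add: r_def field_simps)
    \<comment> \<open>Both corners are on one ray from the origin, and the next lattice point on it
      after the lower corner lies in the segment. Hence it is the upper corner, and the box has only
      four lattice points.\<close>
    have "(\<alpha> ^ Suc a, r * \<alpha> ^ Suc a + 0) \<in>
        convex hull {(\<alpha> ^ a, \<alpha> ^ b), (\<alpha> ^ a, \<alpha> ^ b), (\<alpha> ^ A, \<alpha> ^ B)}"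
      by (rule line_at[of _ "\<alpha> ^ a" _ _ "\<alpha> ^ A"])
        (use 2 r in \<open>simp_all add: hull_inc del: power_Suc\<close>)
    moreover have "r * \<alpha> ^ Suc a + 0 = \<alpha> ^ Suc b"
      using r by simp
    ultimately have "(Suc a, Suc b) \<in> {(a, b), (a, b), (A, B)}"
      using emptyD[OF P P R, of "Suc a" "Suc b"] by (simp del: power_Suc)
    then have "V \<subseteq> {a, Suc a} \<times> {b, Suc b}"
      using box by fastforce
    then have "card V \<le> card ({a, Suc a} \<times> {b, Suc b})"
      by (intro card_mono) auto
    then show ?thesis
      using k1 by (simp add: card_cartesian_product)
  next
    case 3
    define s where "s = (\<alpha> ^ B - \<alpha> ^ b) / (\<alpha> ^ A - \<alpha> ^ a)"
    define t where "t = s * \<alpha> ^ a - \<alpha> ^ b"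
    have "s * (\<alpha> ^ A - \<alpha> ^ a) = \<alpha> ^ B - \<alpha> ^ b"
      using 3 pow_less[of a A] by (simp add: s_def del: pow_less)
    then have "\<alpha> ^ B = s * \<alpha> ^ A - t"
      by (simp add: t_def algebra_simps)
    moreover have "\<alpha> ^ b = s * \<alpha> ^ a - t"
      by (simp add: t_def)
    ultimately interpret steep_diagonal \<alpha> V a b A B k s t
      using k P R 3 box by unfold_locales fastforce+
    show ?thesis by (rule card_diagonal)
  qed
qed

lemma card_le:
  assumes k: "\<alpha> \<le> \<alpha> ^ k * (\<alpha> - 1)"
  shows "card V \<le> 2 * k + 3"
proof (cases "V = {}")
  case False
  interpret swapped: empty_exponents \<alpha> "prod.swap ` V" by (rule swap)
  define a where "a = Min (fst ` V)"
  define A where "A = Max (fst ` V)"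
  define b where "b = Min (snd ` V)"
  define B where "B = Max (snd ` V)"
  have box: "a \<le> fst z \<and> fst z \<le> A \<and> b \<le> snd z \<and> snd z \<le> B" if "z \<in> V" for z
    using that fin by (auto simp: a_def A_def b_def B_def)
  have "a \<in> fst ` V" "A \<in> fst ` V" "b \<in> snd ` V" "B \<in> snd ` V"
    using fin False by (auto simp: a_def A_def b_def B_def)
  then obtain y1 y2 x1 x2 where sides: "(a, y1) \<in> V" "(A, y2) \<in> V" "(x1, b) \<in> V" "(x2, B) \<in> V"
    by fastforce
  have "(a, b) \<in> V \<or> (a, B) \<in> V"
    by (rule left_corner[OF _ sides(1,3,4)]) (use box in auto)
  moreover have "(A, b) \<in> V \<or> (A, B) \<in> V"
    by (rule right_corner[OF _ sides(2,3,4)]) (use box in auto)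
  moreover have "(b, a) \<in> prod.swap ` V \<or> (b, A) \<in> prod.swap ` V"
    by (rule swapped.left_corner[of _ _ _ x1 y1 y2]) (use box sides in force)+
  moreover have "(B, a) \<in> prod.swap ` V \<or> (B, A) \<in> prod.swap ` V"
    by (rule swapped.right_corner[of _ _ _ x2 y1 y2]) (use box sides in force)+
  \<comment> \<open>Each of the four sides of the box has an endpoint in \<open>V\<close>, which
    forces two opposite corners.\<close>
  ultimately consider "(a, B) \<in> V" "(A, b) \<in> V" | "(a, b) \<in> V" "(A, B) \<in> V"
    by auto
  then show ?thesis
  proof cases
    case 1
    then show ?thesis by (intro card_antidiagonal[OF k box])
  next
    case 2
    show ?thesis
    proof (cases "A + b \<le> B + a")
      case True
      then show ?thesis using 2 by (intro card_diagonal_steep[OF k box])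
    next
      case False
      \<comment> \<open>Exchanging the coordinates turns a flat diagonal into a steep one.\<close>
      have "card (prod.swap ` V) \<le> 2 * k + 3"
        by (rule swapped.card_diagonal_steep[OF k, of b B a A]) (use 2 box False in force)+
      then show ?thesis by (simp add: card_image)
    qed
  qed
qed simp

end

section \<open>From exponent sets to empty polygons\<close>

lemma h_exponential_lattice_le:
  assumes "\<alpha> > 1" and k: "\<alpha> \<le> \<alpha> ^ k * (\<alpha> - 1)"
  shows "h (exponential_lattice \<alpha>) \<le> enat (2 * k + 3)"
  unfolding h_def
proof (rule SUP_least)
  fix P assume "P \<in> {P. empty_polygon_in (exponential_lattice \<alpha>) P}"
  then have P: "polytope P" "vertices P \<subseteq> exponential_lattice \<alpha>"
    "P \<inter> exponential_lattice \<alpha> \<subseteq> vertices P"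
    by (auto simp: empty_polygon_in_def convex_polygon_def)
  define g where "g = (\<lambda>(i::nat, j::nat). (\<alpha> ^ i, \<alpha> ^ j))"
  define V where "V = {z. g z \<in> vertices P}"
  have g: "inj g"
    using assms(1) by (auto simp: g_def inj_def)
  have im: "g ` V = vertices P"
    using P(2) by (force simp: V_def g_def exponential_lattice_def)
  have "finite (vertices P)"
    using P(1) by (simp add: vertices_def finite_polyhedron_extreme_points polytope_imp_polyhedron)
  then have finV: "finite V"
    unfolding V_def using g by (intro finite_vimageI[unfolded vimage_def])
  interpret empty_exponents \<alpha> V
  proof
    fix a b c d e f i j
    let ?T = "{(\<alpha> ^ a, \<alpha> ^ b), (\<alpha> ^ c, \<alpha> ^ d), (\<alpha> ^ e, \<alpha> ^ f)}"
    assume "(a, b) \<in> V" "(c, d) \<in> V" "(e, f) \<in> V" and ij: "(\<alpha> ^ i, \<alpha> ^ j) \<in> convex hull ?T"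
    then have "?T \<subseteq> P"
      by (auto simp: V_def g_def vertices_def extreme_point_of_def)
    then have sub: "convex hull ?T \<subseteq> P"
      using P(1) by (simp add: hull_minimal polytope_imp_convex)
    have "(\<alpha> ^ i, \<alpha> ^ j) \<in> exponential_lattice \<alpha>"
      by (simp add: exponential_lattice_def)
    \<comment> \<open>Emptiness makes the lattice point a vertex of \<open>P\<close>. It stays
      extreme in the smaller triangle, so it is one of its corners.\<close>
    then have "(\<alpha> ^ i, \<alpha> ^ j) extreme_point_of P"
      using P(3) sub ij by (auto simp: vertices_def)
    then have "(\<alpha> ^ i, \<alpha> ^ j) extreme_point_of (convex hull ?T)"
      using sub ij by (auto simp: extreme_point_of_def)
    then have "(\<alpha> ^ i, \<alpha> ^ j) \<in> ?T"
      by (rule extreme_point_of_convex_hull)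
    then show "(i, j) \<in> {(a, b), (c, d), (e, f)}"
      using assms(1) by auto
  qed (use assms finV in auto)
  have "card (vertices P) = card V"
    using g by (simp add: card_image inj_on_subset flip: im)
  then show "enat (card (vertices P)) \<le> enat (2 * k + 3)"
    using card_le[OF k] by simp
qed

theorem theorem2:
  fixes \<alpha> :: real
  assumes "\<alpha> > 1"
  shows "h (exponential_lattice \<alpha>) < \<infinity>
    \<and> (\<alpha> \<ge> 2 \<longrightarrow> h (exponential_lattice \<alpha>) \<le> 5)
    \<and> (\<alpha> \<in> {(1 + sqrt 5) / 2..<2} \<longrightarrow> h (exponential_lattice \<alpha>) \<le> 7)
    \<and> (\<alpha> \<in> {1<..<(1 + sqrt 5) / 2} \<longrightarrow>
         h (exponential_lattice \<alpha>) \<le> enat (nat (3 * \<lceil>log \<alpha> (\<alpha> / (\<alpha> - 1))\<rceil> + 3)))"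
proof (intro conjI impI)
  define k where "k = nat \<lceil>log \<alpha> (\<alpha> / (\<alpha> - 1))\<rceil>"
  have pos: "\<alpha> / (\<alpha> - 1) > 1"
    using assms by simp
  then have "log \<alpha> (\<alpha> / (\<alpha> - 1)) > 0"
    using assms by simp
  then have k: "int k = \<lceil>log \<alpha> (\<alpha> / (\<alpha> - 1))\<rceil>"
    by (simp add: k_def)
  have "log \<alpha> (\<alpha> / (\<alpha> - 1)) \<le> real k"
    unfolding k_def by (rule real_nat_ceiling_ge)
  then have "\<alpha> / (\<alpha> - 1) \<le> \<alpha> powr real k"
    using assms pos by (simp add: log_le_iff)
  then have "\<alpha> \<le> \<alpha> ^ k * (\<alpha> - 1)"
    using assms by (simp add: powr_realpow divide_simps)
  from h_exponential_lattice_le[OF assms this]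
  have le: "h (exponential_lattice \<alpha>) \<le> enat (2 * k + 3)" .
  then show "h (exponential_lattice \<alpha>) < \<infinity>"
    by (rule le_less_trans) simp
  \<comment> \<open>The bound \<open>2 * k + 3\<close> is at most the claimed one;
    \<open>nat\<close> truncates nothing because the logarithm is positive.\<close>
  have "nat (3 * \<lceil>log \<alpha> (\<alpha> / (\<alpha> - 1))\<rceil> + 3) = 3 * k + 3"
    unfolding k[symmetric] by simp
  then show "h (exponential_lattice \<alpha>) \<le> enat (nat (3 * \<lceil>log \<alpha> (\<alpha> / (\<alpha> - 1))\<rceil> + 3))"
    using le by (auto intro: order_trans)
next
  assume "\<alpha> \<ge> 2"
  \<comment> \<open>Here \<open>k = 1\<close> suffices since \<open>\<alpha> - 1\<close> is at least
    1.\<close>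
  then have "\<alpha> \<le> \<alpha> ^ 1 * (\<alpha> - 1)"
    by simp
  from h_exponential_lattice_le[OF assms this] show "h (exponential_lattice \<alpha>) \<le> 5"
    by (simp add: numeral_eq_enat)
next
  assume "\<alpha> \<in> {(1 + sqrt 5) / 2..<2}"
  then have "sqrt 5 \<le> 2 * \<alpha> - 1"
    by simp
  then have "(sqrt 5)\<^sup>2 \<le> (2 * \<alpha> - 1)\<^sup>2"
    by (intro power_mono) auto
  \<comment> \<open>From the golden ratio on, \<open>\<alpha> * \<alpha> - \<alpha>\<close> is at
    least 1, so \<open>k = 2\<close> suffices.\<close>
  then have "\<alpha> * 1 \<le> \<alpha> * (\<alpha> * \<alpha> - \<alpha>)"
    using assms by (intro mult_left_mono) (auto simp: power2_eq_square algebra_simps)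
  then have "\<alpha> \<le> \<alpha> ^ 2 * (\<alpha> - 1)"
    by (simp add: power2_eq_square algebra_simps)
  from h_exponential_lattice_le[OF assms this] show "h (exponential_lattice \<alpha>) \<le> 7"
    by (simp add: numeral_eq_enat)
qed

end
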